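(* For every $\varepsilon>0$ there is a constant $C_\varepsilon<\infty$ such that for every $0<\theta\le1$, every $n\ge1$ and every collection $L$ of $n$ lines in $\mathbb R^3$, the number of $\theta$-transverse joints of $L$ is at most $C_\varepsilon\,n^{3/2+\varepsilon}\,\theta^{-1/2-\varepsilon}$.
   Context: Three concurrent lines $l,l',l''$ in $\mathbb R^3$ are called $\theta$-transverse if the parallelepiped generated by unit vectors parallel to $l,l',l''$ has volume at least $\theta$. A $\theta$-transverse joint of $L$ is a point of $\mathbb R^3$ which is contained in at least one triple $(l,l',l'')$ of $\theta$-transverse concurrent lines in $L$ (a point arising from several triples is counted only once). *)

theory Defs
  imports "HOL-Analysis.Analysis"
begin

definition is_line :: "(real^3) set \<Rightarrow> bool" where
  "is_line l \<longleftrightarrow> affine l \<and> aff_dim l = 1"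

definition unit_direction :: "real^3 \<Rightarrow> (real^3) set \<Rightarrow> bool" where
  "unit_direction u l \<longleftrightarrow> norm u = 1 \<and> affine_parallel (span {u}) l"

definition parallelepiped :: "real^3 \<Rightarrow> real^3 \<Rightarrow> real^3 \<Rightarrow> (real^3) set" where
  "parallelepiped u v w =
     {a *\<^sub>R u + b *\<^sub>R v + c *\<^sub>R w | a b c. a \<in> {0..1} \<and> b \<in> {0..1} \<and> c \<in> {0..1}}"

(* The volume does not depend on the choice of the unit vectors, each of which is
   determined by its line up to sign; hence the existential quantifier. *)
definition transverse ::
    "real \<Rightarrow> (real^3) set \<Rightarrow> (real^3) set \<Rightarrow> (real^3) set \<Rightarrow> bool" where
  "transverse \<theta> l l' l'' \<longleftrightarrow>
     l \<inter> l' \<inter> l'' \<noteq> {} \<and>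
     (\<exists>u v w. unit_direction u l \<and> unit_direction v l' \<and> unit_direction w l'' \<and>
        measure lebesgue (parallelepiped u v w) \<ge> \<theta>)"

definition transverse_joints :: "real \<Rightarrow> (real^3) set set \<Rightarrow> (real^3) set" where
  "transverse_joints \<theta> L =
     {p. \<exists>l\<in>L. \<exists>l'\<in>L. \<exists>l''\<in>L. transverse \<theta> l l' l'' \<and> p \<in> l \<inter> l' \<inter> l''}"

end

theory Submission
  imports Defs "HOL-Computational_Algebra.Polynomial"
begin

text \<open>
  The bound is a consequence of the joints theorem of Guth and Katz: if \<open>n\<close> lines in
  \<open>\<real>\<^sup>3\<close> are given, then at most \<open>sqrt 27 * n powr (3/2)\<close> points lie on three of them with linearly
  independent directions. A \<open>\<theta>\<close>-transverse joint is such a point, because three dependent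
  vectors span a parallelepiped of volume \<open>0\<close>; and since \<open>n \<ge> 1\<close> and \<open>\<theta> \<le> 1\<close>, the factors
  \<open>n powr \<epsilon>\<close> and \<open>\<theta> powr (-1/2 - \<epsilon>)\<close> are at least \<open>1\<close>.

  The joints theorem is proved by the polynomial method, in the form due to Quilodran and to
  Kaplan, Sharir and Shustin, and most of the argument works in \<open>\<real>\<^sup>N\<close>. Let \<open>J\<close> be a
  nonempty finite set of joints with fewer than \<open>(k + 1)^N\<close> points. Counting dimensions gives
  a nonzero polynomial function of degree at most \<open>N * k\<close> that vanishes on \<open>J\<close>
  (\<open>exists_polyfun_le_vanishing\<close>); let \<open>f\<close> be one of least degree. If every line contained more
  than \<open>N * k\<close> points of \<open>J\<close>, then \<open>f\<close> would vanish on every line. At each point of \<open>J\<close> its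
  derivative would then vanish in a spanning set of directions, hence in every direction. So
  all directional derivatives of \<open>f\<close> would vanish on \<open>J\<close>, and, having smaller degree, would be
  identically zero. Then \<open>f\<close> would be constant, hence zero, a contradiction. Therefore some line
  contains at most \<open>N * k\<close> points of \<open>J\<close> (\<open>exists_line_with_few_joints\<close>).

  Deleting that line destroys at most \<open>N * k\<close> points of \<open>J\<close>, so repeating this gives
  \<open>card J \<le> n * N * k\<close> (\<open>card_joints_le_lines_times_degree\<close>). For \<open>N = 3\<close>, taking \<open>k\<close> least
  gives \<open>k^3 \<le> card J\<close>, whence \<open>(card J)^2 \<le> 27 * n^3\<close>.
\<close>

section \<open>Polynomial functions of bounded degree\<close>

text \<open>
  Polynomial functions are generated directly as functions, without coefficients: every
  property used below (restriction to a line, differentiation) then follows by rule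
  induction. The index is an upper bound for the degree, so constants have every degree.
\<close>

inductive polyfun_le :: "nat \<Rightarrow> (real^'n \<Rightarrow> real) \<Rightarrow> bool" where
  const: "polyfun_le d (\<lambda>_. c)"
| add: "polyfun_le d f \<Longrightarrow> polyfun_le d g \<Longrightarrow> polyfun_le d (\<lambda>x. f x + g x)"
| mult: "polyfun_le d f \<Longrightarrow> polyfun_le (Suc d) (\<lambda>x. x $ m * f x)"

lemma polyfun_le_scale: "polyfun_le d f \<Longrightarrow> polyfun_le d (\<lambda>x. c * f x)"
proof (induction rule: polyfun_le.induct)
  case (const d a)
  show ?case by (rule polyfun_le.const)
next
  case (add d f g)
  then show ?case using polyfun_le.add[of d "\<lambda>x. c * f x" "\<lambda>x. c * g x"]
    by (simp add: distrib_left)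
next
  case (mult d f m)
  then show ?case using polyfun_le.mult[of d "\<lambda>x. c * f x" m]
    by (simp add: mult.left_commute)
qed

lemma polyfun_le_Suc: "polyfun_le d f \<Longrightarrow> polyfun_le (Suc d) f"
  by (induction rule: polyfun_le.induct) (auto intro: polyfun_le.intros)

lemma polyfun_le_sum:
  assumes "\<And>i. i \<in> I \<Longrightarrow> polyfun_le d (f i)"
  shows "polyfun_le d (\<lambda>x. \<Sum>i\<in>I. f i x)"
  using assms by (induction I rule: infinite_finite_induct) (auto intro: polyfun_le.intros)

lemma polyfun_le_prod_linear:
  assumes "finite I"
  shows "polyfun_le (card I) (\<lambda>x. \<Prod>i\<in>I. x $ m i - a i)"
  using assms
proof (induction I)
  case empty
  show ?case by (simp add: polyfun_le.const)
next
  case (insert i I)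
  let ?f = "\<lambda>x. \<Prod>i\<in>I. x $ m i - a i"
  have "polyfun_le (Suc (card I)) (\<lambda>x. x $ m i * ?f x + (- a i) * ?f x)"
    using insert.IH by (intro polyfun_le.add polyfun_le.mult polyfun_le_Suc polyfun_le_scale)
  moreover have "(\<lambda>x. x $ m i * ?f x + (- a i) * ?f x) = (\<lambda>x. \<Prod>i\<in>insert i I. x $ m i - a i)"
    using insert.hyps by (simp add: algebra_simps)
  ultimately show ?case using insert.hyps by simp
qed

lemma polyfun_le_on_line:
  "polyfun_le d f \<Longrightarrow> \<exists>q. degree q \<le> d \<and> (\<forall>t. poly q t = f (a + t *\<^sub>R u))"
proof (induction rule: polyfun_le.induct)
  case (const d c)
  show ?case by (rule exI[of _ "[:c:]"]) simp
next
  case (add d f g)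
  then obtain q r where "degree q \<le> d" "\<forall>t. poly q t = f (a + t *\<^sub>R u)"
    "degree r \<le> d" "\<forall>t. poly r t = g (a + t *\<^sub>R u)" by blast
  then show ?case by (intro exI[of _ "q + r"]) (simp add: degree_add_le)
next
  case (mult d f m)
  then obtain q where q: "degree q \<le> d" "\<forall>t. poly q t = f (a + t *\<^sub>R u)" by blast
  have "degree ([:a $ m, u $ m:] * q) \<le> degree [:a $ m, u $ m:] + degree q"
    by (rule degree_mult_le)
  also have "\<dots> \<le> Suc d" using q(1) by simp
  finally show ?case using q(2) by (intro exI[of _ "[:a $ m, u $ m:] * q"]) (simp add: algebra_simps)
qed

lemma polyfun_le_vanishes_on_line:
  assumes f: "polyfun_le d f"
    and fin: "finite S" and sub: "S \<subseteq> range (\<lambda>t. a + t *\<^sub>R u)" and card: "d < card S"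
    and zero: "\<And>x. x \<in> S \<Longrightarrow> f x = 0"
  shows "f (a + t *\<^sub>R u) = 0"
proof -
  obtain q where q: "degree q \<le> d" "\<And>t. poly q t = f (a + t *\<^sub>R u)"
    using polyfun_le_on_line[OF f] by blast
  have "q = 0"
  proof (rule ccontr)
    assume "q \<noteq> 0"
    have "S \<subseteq> (\<lambda>t. a + t *\<^sub>R u) ` {t. poly q t = 0}"
    proof
      fix x assume x: "x \<in> S"
      then obtain t where "x = a + t *\<^sub>R u" using sub by blast
      then show "x \<in> (\<lambda>t. a + t *\<^sub>R u) ` {t. poly q t = 0}"
        using zero[OF x] q(2)[of t] by auto
    qed
    then have "card S \<le> card {t. poly q t = 0}"
      using poly_roots_finite[OF \<open>q \<noteq> 0\<close>] by (meson card_image_le card_mono finite_imageI le_trans)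
    also have "\<dots> \<le> degree q" by (rule card_poly_roots_bound[OF \<open>q \<noteq> 0\<close>])
    finally show False using card q(1) by simp
  qed
  then show ?thesis using q(2)[of t] by simp
qed

text \<open>
  The degree drops by one, except for constants, where truncated subtraction makes
  \<open>d - 1 = 0\<close>. The last clause supplies the missing information there; the
  product rule needs it to differentiate a coordinate times a constant.
\<close>

lemma polyfun_le_derivative:
  fixes f :: "real^'n \<Rightarrow> real"
  shows "polyfun_le d f \<Longrightarrow>
    \<exists>f'. (\<forall>x. (f has_derivative f' x) (at x)) \<and> (\<forall>v. polyfun_le (d - 1) (\<lambda>x. f' x v))
       \<and> (d = 0 \<longrightarrow> (\<forall>x v. f' x v = 0))"
proof (induction rule: polyfun_le.induct)
  case (const d c)
  show ?case
    by (rule exI[of _ "\<lambda>x v. 0"]) (auto intro: polyfun_le.const)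
next
  case (add d f g)
  then obtain f' g' where
    "\<forall>x. (f has_derivative f' x) (at x)" "\<forall>v. polyfun_le (d - 1) (\<lambda>x. f' x v)"
    "d = 0 \<longrightarrow> (\<forall>x v. f' x v = 0)"
    "\<forall>x. (g has_derivative g' x) (at x)" "\<forall>v. polyfun_le (d - 1) (\<lambda>x. g' x v)"
    "d = 0 \<longrightarrow> (\<forall>x v. g' x v = 0)" by metis
  then show ?case
    by (intro exI[of _ "\<lambda>x v. f' x v + g' x v"])
      (auto intro: polyfun_le.add has_derivative_add)
next
  case (mult d f m)
  then obtain f' where f': "\<forall>x. (f has_derivative f' x) (at x)"
    "\<forall>v. polyfun_le (d - 1) (\<lambda>x. f' x v)" "d = 0 \<longrightarrow> (\<forall>x v. f' x v = 0)" by metis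
  have "((\<lambda>x. x $ m * f x) has_derivative (\<lambda>v. x $ m * f' x v + v $ m * f x)) (at x)" for x
    using f'(1) by (intro has_derivative_mult bounded_linear_imp_has_derivative bounded_linear_vec_nth) simp
  moreover have "polyfun_le d (\<lambda>x. x $ m * f' x v + v $ m * f x)" for v
  proof (cases d)
    case 0
    then show ?thesis using f'(3) polyfun_le_scale[OF mult.hyps] by simp
  next
    case (Suc e)
    have "polyfun_le d (\<lambda>x. x $ m * f' x v)"
      using f'(2) Suc by (auto intro: polyfun_le.mult)
    then show ?thesis using polyfun_le_scale[OF mult.hyps] by (intro polyfun_le.add)
  qed
  ultimately show ?case
    by (intro exI[of _ "\<lambda>x v. x $ m * f' x v + v $ m * f x"]) simp
qed

section \<open>Polynomials vanishing on a given finite set\<close>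

text \<open>
  Gaussian elimination, one equation at a time: an equation with a nonzero coefficient at \<open>j\<close>
  is solved for the unknown \<open>j\<close> and substituted into the others.
\<close>

lemma underdetermined_system_nontrivial_solution:
  fixes a :: "'s \<Rightarrow> 'i \<Rightarrow> real"
  assumes "finite S" "finite I" "card S < card I"
  shows "\<exists>c. (\<exists>i\<in>I. c i \<noteq> 0) \<and> (\<forall>s\<in>S. (\<Sum>i\<in>I. c i * a s i) = 0)"
  using assms
proof (induction S arbitrary: I a rule: finite_induct)
  case empty
  then have "I \<noteq> {}" by auto
  then show ?case by (intro exI[of _ "\<lambda>_. 1"]) auto
next
  case (insert s S)
  show ?case
  proof (cases "\<forall>i\<in>I. a s i = 0")
    case True
    have "card S < card I" using insert by simp
    with insert.IH[OF insert.prems(1) this] show ?thesis using True by auto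
  next
    case False
    then obtain j where j: "j \<in> I" "a s j \<noteq> 0" by blast
    define I' where "I' = I - {j}"
    have I: "I = insert j I'" "j \<notin> I'" "finite I'"
      using j insert.prems(1) by (auto simp: I'_def)
    then have "card S < card I'"
      using insert.prems insert.hyps by simp
    from insert.IH[OF I(3) this, of "\<lambda>t i. a t i - a s i / a s j * a t j"]
    obtain c where c: "\<exists>i\<in>I'. c i \<noteq> 0"
      "\<And>t. t \<in> S \<Longrightarrow> (\<Sum>i\<in>I'. c i * (a t i - a s i / a s j * a t j)) = 0" by blast
    define e where "e = - (\<Sum>i\<in>I'. c i * a s i) / a s j"
    define c' where "c' = c(j := e)"
    have sum: "(\<Sum>i\<in>I. c' i * a t i) = e * a t j + (\<Sum>i\<in>I'. c i * a t i)" for t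
    proof -
      have "(\<Sum>i\<in>I'. c' i * a t i) = (\<Sum>i\<in>I'. c i * a t i)"
        using I(2) by (intro sum.cong) (auto simp: c'_def)
      then show ?thesis using I by (simp add: c'_def)
    qed
    have "(\<Sum>i\<in>I. c' i * a t i) = 0" if "t \<in> S" for t
    proof -
      have "(\<Sum>i\<in>I'. c i * (a t i - a s i / a s j * a t j))
          = (\<Sum>i\<in>I'. c i * a t i) - (\<Sum>i\<in>I'. c i * a s i) / a s j * a t j"
        by (simp add: right_diff_distrib sum_subtractf sum_distrib_right sum_divide_distrib mult.assoc)
      then show ?thesis using c(2)[OF that] by (simp add: sum e_def)
    qed
    moreover have "(\<Sum>i\<in>I. c' i * a s i) = 0"
      using j by (simp add: sum e_def)
    moreover have "\<exists>i\<in>I. c' i \<noteq> 0"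
      using c(1) I by (auto simp: c'_def)
    ultimately show ?thesis by (intro exI[of _ c']) auto
  qed
qed

text \<open>
  The polynomial is sought in the span of the Lagrange functions of the grid \<open>{0..k}\<^sup>N\<close>, one for
  each grid point. Vanishing on \<open>S\<close> imposes fewer linear conditions than there are
  grid points, so a nontrivial combination satisfies them. Its value at a
  grid point is a nonzero multiple of the corresponding coefficient, so the combination
  is a nonzero function; linear independence of monomials is thereby avoided.
\<close>

lemma exists_polyfun_le_vanishing:
  fixes S :: "(real^'n) set"
  assumes fin: "finite S" and card: "card S < (k + 1) ^ CARD('n)"
  shows "\<exists>f. polyfun_le (CARD('n) * k) f \<and> (\<exists>x. f x \<noteq> 0) \<and> (\<forall>x\<in>S. f x = 0)"
proof -
  define G :: "('n \<Rightarrow> nat) set" where "G = PiE UNIV (\<lambda>_. {..k})"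
  have G: "finite G" "card G = (k + 1) ^ CARD('n)"
    by (simp_all add: G_def finite_PiE card_PiE)
  \<comment> \<open>The Lagrange function of \<open>g\<close> is a product of factors \<open>x $ m - a\<close>, one for each
    coordinate \<open>m\<close> and each \<open>a \<le> k\<close> other than \<open>g m\<close>; \<open>R g\<close> indexes these factors.\<close>
  define R where "R g = (SIGMA m:UNIV. {..k} - {g m})" for g :: "'n \<Rightarrow> nat"
  define ell where "ell g x = (\<Prod>i\<in>R g. x $ fst i - real (snd i))"
    for g :: "'n \<Rightarrow> nat" and x :: "real^'n"
  define pt :: "('n \<Rightarrow> nat) \<Rightarrow> real^'n" where "pt g = (\<chi> m. real (g m))" for g
  have finR: "finite (R g)" for g by (simp add: R_def)
  have cardR: "card (R g) = CARD('n) * k" if "g \<in> G" for g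
  proof -
    have "card ({..k} - {g m}) = k" for m
      using that by (simp add: G_def PiE_iff)
    then show ?thesis by (simp add: R_def card_SigmaI)
  qed
  have deg: "polyfun_le (CARD('n) * k) (ell g)" if "g \<in> G" for g
    using polyfun_le_prod_linear[OF finR, of g fst "\<lambda>i. real (snd i)"] cardR[OF that]
    by (simp add: ell_def[abs_def])
  have diag: "ell g (pt g) \<noteq> 0" for g
    using finR[of g] by (auto simp: ell_def pt_def R_def)
  have offdiag: "ell g (pt h) = 0" if "g \<noteq> h" "h \<in> G" for g h
  proof -
    have "\<exists>m. g m \<noteq> h m" using that(1) by auto
    then obtain m where "g m \<noteq> h m" ..
    then have "(m, h m) \<in> R g" using that(2) by (auto simp: R_def G_def PiE_iff)
    then show ?thesis using finR[of g] by (force simp: ell_def pt_def)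
  qed
  obtain c where c: "\<exists>g\<in>G. c g \<noteq> 0" "\<forall>x\<in>S. (\<Sum>g\<in>G. c g * ell g x) = 0"
    using underdetermined_system_nontrivial_solution[OF fin G(1), of "\<lambda>x g. ell g x"] card G(2)
    by auto
  define f where "f x = (\<Sum>g\<in>G. c g * ell g x)" for x
  have "polyfun_le (CARD('n) * k) f"
    unfolding f_def[abs_def] by (intro polyfun_le_sum polyfun_le_scale deg)
  moreover obtain h where h: "h \<in> G" "c h \<noteq> 0" using c(1) by blast
  have "f (pt h) = (\<Sum>g\<in>G. if g = h then c h * ell h (pt h) else 0)"
    unfolding f_def using h offdiag by (intro sum.cong) auto
  then have "f (pt h) \<noteq> 0" using h G diag by simp
  moreover have "\<forall>x\<in>S. f x = 0" using c(2) by (simp add: f_def)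
  ultimately show ?thesis by blast
qed

section \<open>Joints and the polynomial method\<close>

text \<open>
  In \<open>\<real>\<^sup>N\<close>, a point is a joint if the directions of the lines through it span the whole
  space. Lines are given by parametrisations from \<open>p\<close>, so that membership of \<open>p\<close> is
  built in and arbitrary sets may belong to \<open>L\<close>.
\<close>

definition joint :: "(real^'n) set set \<Rightarrow> real^'n \<Rightarrow> bool" where
  "joint L p \<longleftrightarrow> span {u. u \<noteq> 0 \<and> range (\<lambda>t. p + t *\<^sub>R u) \<in> L} = UNIV"

lemma joint_remove_line:
  assumes "joint L p" "p \<notin> l"
  shows "joint (L - {l}) p"
proof -
  have "range (\<lambda>t. p + t *\<^sub>R u) \<noteq> l" for u
    using assms(2) by (metis add.right_neutral rangeI scaleR_zero_left)
  then show ?thesis using assms(1) by (simp add: joint_def)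
qed

text \<open>
  A nonzero polynomial of least degree vanishing on \<open>J\<close> would, if every line met \<open>J\<close> in more
  points than its degree, have all its directional derivatives vanish on \<open>J\<close> as well; these
  have smaller degree, so minimality forces them to be zero.
\<close>

lemma exists_line_with_few_joints:
  fixes L :: "(real^'n) set set"
  assumes fin: "finite J" and ne: "J \<noteq> {}" and joint: "\<And>p. p \<in> J \<Longrightarrow> joint L p"
    and card: "card J < (k + 1) ^ CARD('n)"
  shows "\<exists>l\<in>L. card (J \<inter> l) \<le> CARD('n) * k"
proof (rule ccontr)
  assume "\<not> ?thesis"
  then have many: "CARD('n) * k < card (J \<inter> l)" if "l \<in> L" for l
    using that by force
  define Q where
    "Q d \<longleftrightarrow> (\<exists>f :: real^'n \<Rightarrow> real. polyfun_le d f \<and> (\<exists>x. f x \<noteq> 0) \<and> (\<forall>x\<in>J. f x = 0))" for d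
  define d where "d = (LEAST d. Q d)"
  have ex: "Q (CARD('n) * k)"
    using exists_polyfun_le_vanishing[OF fin card] by (simp add: Q_def)
  have "Q d" unfolding d_def by (rule LeastI[of Q, OF ex])
  then obtain f :: "real^'n \<Rightarrow> real" where
    f: "polyfun_le d f" "\<exists>x. f x \<noteq> 0" "\<And>x. x \<in> J \<Longrightarrow> f x = 0"
    unfolding Q_def by blast
  have dle: "d \<le> CARD('n) * k" unfolding d_def by (rule Least_le[of Q, OF ex])
  obtain f' where f': "\<And>x. (f has_derivative f' x) (at x)"
    "\<And>v. polyfun_le (d - 1) (\<lambda>x. f' x v)" "d = 0 \<longrightarrow> (\<forall>x v. f' x v = 0)"
    using polyfun_le_derivative[OF f(1)] by metis
  \<comment> \<open>Since \<open>f\<close> vanishes on each line of \<open>L\<close> through \<open>p\<close>, it has zero derivative in a spanning set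
    of directions.\<close>
  have crit: "f' p v = 0" if p: "p \<in> J" for p v
  proof -
    let ?D = "{u. u \<noteq> 0 \<and> range (\<lambda>t. p + t *\<^sub>R u) \<in> L}"
    have lin: "linear (f' p)" using f'(1) by (rule has_derivative_linear)
    have "f' p u = 0" if u: "u \<in> ?D" for u
    proof -
      have line: "f (p + t *\<^sub>R u) = 0" for t
        using u fin dle many[of "range (\<lambda>t. p + t *\<^sub>R u)"] f(3)
        by (intro polyfun_le_vanishes_on_line[OF f(1), where S = "J \<inter> range (\<lambda>t. p + t *\<^sub>R u)"]) auto
      have "((\<lambda>t. f (p + t *\<^sub>R u)) has_derivative (\<lambda>t. f' p (t *\<^sub>R u))) (at 0)"
        by (rule has_derivative_compose[of "\<lambda>t. p + t *\<^sub>R u" "\<lambda>t. t *\<^sub>R u" 0 UNIV f "f' p"])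
          (auto intro!: derivative_eq_intros f'(1))
      then have "((\<lambda>t::real. 0::real) has_derivative (\<lambda>t. f' p (t *\<^sub>R u))) (at 0)"
        by (simp add: line)
      then have "(\<lambda>t::real. f' p (t *\<^sub>R u)) = (\<lambda>t. 0)"
        by (rule has_derivative_unique) (rule has_derivative_const)
      from fun_cong[OF this, of 1] show ?thesis by simp
    qed
    moreover have "v \<in> span ?D" using joint[OF p] by (simp add: joint_def)
    ultimately show ?thesis using linear_eq_0_on_span[OF lin] by blast
  qed
  have "f' x v = 0" for x v
  proof (cases "d = 0")
    case True
    then show ?thesis using f'(3) by simp
  next
    case False
    then have "\<not> Q (d - 1)" using not_less_Least[of "d - 1" Q] by (simp add: d_def)
    then show ?thesis using f'(2)[of v] crit unfolding Q_def by blast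
  qed
  then have "(f has_derivative (\<lambda>v. 0)) (at x)" for x
    using f'(1)[of x] by (metis (no_types, lifting) ext)
  then have "\<exists>c. \<forall>x. f x = c"
    using has_derivative_zero_constant[of UNIV f] by auto
  then show False using f(2,3) ne by force
qed

text \<open>
  Induction on the number of lines: remove a line with few points of \<open>J\<close>. The points of \<open>J\<close>
  off that line lose none of their lines and remain joints of the other lines. The
  same \<open>k\<close> serves throughout, since the set of points only shrinks.
\<close>

lemma card_joints_le_lines_times_degree:
  fixes L :: "(real^'n) set set"
  assumes "finite L" "finite J" "\<And>p. p \<in> J \<Longrightarrow> joint L p" "card J < (k + 1) ^ CARD('n)"
  shows "card J \<le> card L * (CARD('n) * k)"
  using assms
proof (induction "card L" arbitrary: L J rule: less_induct)
  case less
  show ?case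
  proof (cases "J = {}")
    case False
    then obtain l where l: "l \<in> L" "card (J \<inter> l) \<le> CARD('n) * k"
      using exists_line_with_few_joints[OF less.prems(2) False less.prems(3,4)] by blast
    have cL: "card L = Suc (card (L - {l}))"
      using card.remove[OF less.prems(1) l(1)] by simp
    have "card (J - l) < (k + 1) ^ CARD('n)"
      using card_mono[OF less.prems(2), of "J - l"] less.prems(4) by auto
    then have "card (J - l) \<le> card (L - {l}) * (CARD('n) * k)"
      using less.prems(1,2) joint_remove_line[OF less.prems(3)]
      by (intro less.hyps) (simp_all add: cL)
    moreover have "card J = card (J \<inter> l) + card (J - l)"
      using less.prems(2) by (rule card_Int_Diff)
    ultimately show ?thesis using l(2) cL by simp
  qed (simp only: card.empty le0)
qed

text \<open>
  The choice of the least \<open>k\<close> with \<open>card J < (k + 1)^3\<close> makes \<open>k\<close> about the cube root of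
  \<open>card J\<close>, so that \<open>card J \<le> 3 * n * k\<close> can be solved for \<open>card J\<close>.
\<close>

lemma joints_bound_real3:
  fixes L :: "(real^3) set set"
  assumes "finite L" "finite J" "\<And>p. p \<in> J \<Longrightarrow> joint L p"
  shows "card J ^ 2 \<le> 27 * card L ^ 3"
proof (cases "card J = 0")
  case False
  define k where "k = (LEAST k. card J < (k + 1) ^ 3)"
  have "card J < (card J + 1) ^ 3"
    by (simp add: power3_eq_cube)
  then have k: "card J < (k + 1) ^ 3"
    unfolding k_def by (rule LeastI)
  have "k \<noteq> 0" using k False by (intro notI) simp
  then obtain j where j: "k = Suc j" by (cases k) auto
  have kle: "k ^ 3 \<le> card J"
    using not_less_Least[of j "\<lambda>k. card J < (k + 1) ^ 3"] j by (simp add: k_def)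
  have "card J \<le> card L * (3 * k)"
    using card_joints_le_lines_times_degree[OF assms, of k] k by simp
  then have "card J ^ 3 \<le> (card L * (3 * k)) ^ 3" by (rule power_mono) simp
  also have "\<dots> = 27 * card L ^ 3 * k ^ 3" by (simp add: power_mult_distrib)
  also have "\<dots> \<le> 27 * card L ^ 3 * card J" using kle by simp
  finally have "card J ^ 2 * card J \<le> 27 * card L ^ 3 * card J"
    by (simp add: power3_eq_cube power2_eq_square)
  then show ?thesis using False by simp
qed simp

section \<open>Transverse joints\<close>

text \<open>
  Otherwise the parallelepiped would lie in a proper subspace, which is a null set.
\<close>

lemma span_of_parallelepiped_volume_pos:
  assumes "measure lebesgue (parallelepiped u v w) > 0"
  shows "span {u, v, w} = UNIV"
proof (rule ccontr)
  assume "span {u, v, w} \<noteq> UNIV"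
  then have "dim (span {u, v, w}) < DIM(real^3)"
    using dim_eq_full[of "{u, v, w}"] dim_subset_UNIV[of "{u, v, w}"] by simp
  moreover have "parallelepiped u v w \<subseteq> span {u, v, w}"
    unfolding parallelepiped_def by (auto intro!: span_add span_scale intro: span_base)
  ultimately have "negligible (parallelepiped u v w)"
    using negligible_lowdim negligible_subset by blast
  then show False using assms negligible_imp_measure0 by fastforce
qed

lemma unit_direction_line_through:
  assumes "unit_direction u l" "p \<in> l"
  shows "u \<noteq> 0" "l = range (\<lambda>t. p + t *\<^sub>R u)"
proof -
  show "u \<noteq> 0" using assms(1) by (auto simp: unit_direction_def)
  obtain a where a: "l = (\<lambda>x. a + x) ` span {u}"
    using assms(1) by (auto simp: unit_direction_def affine_parallel_def)
  then obtain s where s: "p = a + s *\<^sub>R u" using assms(2) by (auto simp: span_singleton)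
  have "a + t *\<^sub>R u = p + (t - s) *\<^sub>R u" "p + t *\<^sub>R u = a + (s + t) *\<^sub>R u" for t
    by (simp_all add: s algebra_simps)
  then have "range (\<lambda>t. a + t *\<^sub>R u) = range (\<lambda>t. p + t *\<^sub>R u)"
    by (metis (no_types, lifting) image_subset_iff rangeI subset_antisym)
  then show "l = range (\<lambda>t. p + t *\<^sub>R u)"
    by (simp add: a span_singleton image_image)
qed

lemma joint_of_transverse_joint:
  assumes "0 < \<theta>" "p \<in> transverse_joints \<theta> L"
  shows "joint L p"
proof -
  obtain l l' l'' where L: "l \<in> L" "l' \<in> L" "l'' \<in> L" "transverse \<theta> l l' l''"
    and p: "p \<in> l" "p \<in> l'" "p \<in> l''"
    using assms(2) by (auto simp: transverse_joints_def)
  obtain u v w where d: "unit_direction u l" "unit_direction v l'" "unit_direction w l''"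
    and vol: "\<theta> \<le> measure lebesgue (parallelepiped u v w)"
    using L(4) by (auto simp: transverse_def)
  have "{u, v, w} \<subseteq> {u. u \<noteq> 0 \<and> range (\<lambda>t. p + t *\<^sub>R u) \<in> L}"
    using unit_direction_line_through[OF d(1) p(1)] unit_direction_line_through[OF d(2) p(2)]
      unit_direction_line_through[OF d(3) p(3)] L by auto
  from span_mono[OF this] show ?thesis
    using span_of_parallelepiped_volume_pos[of u v w] assms(1) vol by (auto simp: joint_def)
qed

theorem theorem7p1:
  fixes \<epsilon> :: real
  assumes "\<epsilon> > 0"
  shows "\<exists>C::real. \<forall>(\<theta>::real) (n::nat) (L::(real^3) set set).
           0 < \<theta> \<and> \<theta> \<le> 1 \<and> n \<ge> 1 \<and> finite L \<and> card L = n \<and> (\<forall>l\<in>L. is_line l) \<longrightarrow>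
           finite (transverse_joints \<theta> L) \<and>
           real (card (transverse_joints \<theta> L))
             \<le> C * real n powr (3/2 + \<epsilon>) * \<theta> powr (- 1/2 - \<epsilon>)"
proof (intro exI[of _ "sqrt 27"] allI impI)
  fix \<theta> :: real and n :: nat and L :: "(real^3) set set"
  assume "0 < \<theta> \<and> \<theta> \<le> 1 \<and> n \<ge> 1 \<and> finite L \<and> card L = n \<and> (\<forall>l\<in>L. is_line l)"
  then have \<theta>: "0 < \<theta>" "\<theta> \<le> 1" and n: "n \<ge> 1" and L: "finite L" "card L = n" by auto
  let ?J = "transverse_joints \<theta> L"
  have sub: "card J ^ 2 \<le> 27 * n ^ 3" if "finite J" "J \<subseteq> ?J" for J
    using joints_bound_real3[OF L(1) that(1)] joint_of_transverse_joint[OF \<theta>(1)] that(2) L(2)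
    by blast
  \<comment> \<open>The bound on finite sets of joints also excludes infinitely many joints.\<close>
  have "card J \<le> 27 * n ^ 3" if "J \<subseteq> ?J" "finite J" for J
  proof -
    have "card J \<le> card J ^ 2" by (simp add: power2_nat_le_imp_le)
    then show ?thesis using sub[OF that(2,1)] by linarith
  qed
  then have fin: "finite ?J"
    by (metis finite_if_finite_subsets_card_bdd)
  have "real (card ?J) = sqrt (real (card ?J ^ 2))" by simp
  also have "\<dots> \<le> sqrt (real (27 * n ^ 3))"
    using sub[OF fin] by (intro real_sqrt_le_mono of_nat_mono) simp
  also have "\<dots> = sqrt 27 * real n powr (3/2)"
  proof -
    have "sqrt (real n ^ 3) = (real n powr 3) powr (1/2)"
      using n by (simp add: powr_half_sqrt powr_realpow flip: powr_numeral)
    also have "\<dots> = real n powr (3/2)"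
      by (simp add: powr_powr del: powr_numeral)
    finally show ?thesis by (simp add: real_sqrt_mult)
  qed
  also have "\<dots> \<le> sqrt 27 * real n powr (3/2 + \<epsilon>) * 1"
    using n assms by (simp add: powr_mono)
  also have "\<dots> \<le> sqrt 27 * real n powr (3/2 + \<epsilon>) * \<theta> powr (- 1/2 - \<epsilon>)"
  proof (rule mult_left_mono)
    have "\<theta> powr 0 \<le> \<theta> powr (- 1/2 - \<epsilon>)"
      using \<theta> assms by (intro powr_mono') auto
    then show "1 \<le> \<theta> powr (- 1/2 - \<epsilon>)" using \<theta>(1) by simp
  qed simp
  finally show "finite ?J \<and>
      real (card ?J) \<le> sqrt 27 * real n powr (3/2 + \<epsilon>) * \<theta> powr (- 1/2 - \<epsilon>)"
    using fin by blast
qed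

end
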